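(* Let $R$ be a commutative local ring and let $A\in M_2(R)$. Then the following are equivalent: (1) $A\in M_2(R)$ is strongly $P$-clean. (2) $A-A^2\in M_2(P(R))$. (3) $A\in M_2(P(R))$, or $I_2-A\in M_2(P(R))$, or the equation $x^2-\operatorname{tr}(A)\, x+\det(A)=0$ has a root in $P(R)$ and a root in $1+P(R)$.
   Context: Rings are associative with identity. $P(S)$ denotes the prime radical of a ring $S$ (the intersection of all prime ideals of $S$). $M_2(R)$ is the ring of $2\times2$ matrices over $R$ and $M_2(P(R))$ is the set of those with all entries in $P(R)$. An element $a$ of a ring $S$ is strongly $P$-clean if $a=e+w$ with $e=e^2\in S$, $w\in P(S)$ and $ew=we$; here this is applied with $S=M_2(R)$. *)

theory Defs
  imports "HOL-Analysis.Determinants" "HOL-Algebra.Ideal_Product"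
begin

text \<open>The locale \<open>primeideal\<close> of HOL-Algebra is restricted to commutative rings and to the
  elementwise condition; the following is the notion for arbitrary rings with identity.\<close>

definition prime_two_sided_ideal :: "'a set \<Rightarrow> ('a, 'b) ring_scheme \<Rightarrow> bool" where
  "prime_two_sided_ideal P S \<longleftrightarrow>
     ideal P S \<and> P \<noteq> carrier S \<and>
     (\<forall>I J. ideal I S \<longrightarrow> ideal J S \<longrightarrow> ideal_prod S I J \<subseteq> P \<longrightarrow> I \<subseteq> P \<or> J \<subseteq> P)"

definition prime_radical :: "('a, 'b) ring_scheme \<Rightarrow> 'a set" where
  "prime_radical S = carrier S \<inter> \<Inter> {P. prime_two_sided_ideal P S}"

definition strongly_P_clean :: "('a, 'b) ring_scheme \<Rightarrow> 'a \<Rightarrow> bool" where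
  "strongly_P_clean S a \<longleftrightarrow>
     (\<exists>e w. e \<in> carrier S \<and> e \<otimes>\<^bsub>S\<^esub> e = e \<and> w \<in> prime_radical S \<and>
            a = e \<oplus>\<^bsub>S\<^esub> w \<and> e \<otimes>\<^bsub>S\<^esub> w = w \<otimes>\<^bsub>S\<^esub> e)"

definition local_cring :: "('a, 'b) ring_scheme \<Rightarrow> bool" where
  "local_cring R \<longleftrightarrow> cring R \<and> (\<exists>!M. maximalideal M R)"

definition type_ring :: "'a::ring_1 ring" where
  "type_ring = \<lparr>carrier = UNIV, mult = (*), one = 1, zero = 0, add = (+)\<rparr>"

text \<open>The instance of \<open>(*)\<close> on vectors is componentwise, so the product must be \<open>(**)\<close>.\<close>

definition matrix_ring :: "('a::ring_1 ^ 'n ^ 'n) ring" where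
  "matrix_ring = \<lparr>carrier = UNIV, mult = (**), one = mat 1, zero = 0, add = (+)\<rparr>"

definition matrices_over :: "'a set \<Rightarrow> ('a ^ 'n ^ 'n) set" where
  "matrices_over X = {A. \<forall>i j. A $ i $ j \<in> X}"

lemma ring_type_ring: "ring (type_ring :: 'a::ring_1 ring)"
proof (rule ringI)
  show "abelian_group (type_ring :: 'a ring)"
    by (rule abelian_groupI)
      (auto simp: type_ring_def add.assoc add.commute intro: exI[of _ "- x" for x])
  show "monoid (type_ring :: 'a ring)"
    by (rule monoidI) (auto simp: type_ring_def mult.assoc)
qed (auto simp: type_ring_def algebra_simps)

lemma cring_type_ring: "cring (type_ring :: 'a::comm_ring_1 ring)"
  by (intro cring.intro ring_type_ring comm_monoid.intro comm_monoid_axioms.intro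
        ring.is_monoid) (simp add: type_ring_def mult.commute)

lemma ring_matrix_ring: "ring (matrix_ring :: ('a::ring_1 ^ 'n ^ 'n) ring)"
proof (rule ringI)
  show "abelian_group (matrix_ring :: ('a ^ 'n ^ 'n) ring)"
    by (rule abelian_groupI)
      (auto simp: matrix_ring_def add.assoc add.commute intro: exI[of _ "- x" for x])
  show "monoid (matrix_ring :: ('a ^ 'n ^ 'n) ring)"
    by (rule monoidI) (auto simp: matrix_ring_def matrix_mul_assoc)
qed (simp_all add: matrix_ring_def matrix_matrix_mult_def vec_eq_iff sum.distrib
       distrib_left distrib_right)

lemma (in cring) prime_two_sided_ideal_iff_primeideal:
  "prime_two_sided_ideal P R \<longleftrightarrow> primeideal P R"
proof
  assume P: "prime_two_sided_ideal P R"
  then interpret ideal P R by (simp add: prime_two_sided_ideal_def)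
  show "primeideal P R"
  proof (rule primeidealI)
    show "ideal P R" "cring R" "carrier R \<noteq> P"
      using P by (auto simp: prime_two_sided_ideal_def is_cring)
    fix a b assume ab: "a \<in> carrier R" "b \<in> carrier R" "a \<otimes> b \<in> P"
    have "x \<in> P" if "x \<in> ideal_prod R (PIdl a) (PIdl b)" for x
      using that
    proof induction
      case (prod i j)
      then obtain r s where "r \<in> carrier R" "s \<in> carrier R" "i = r \<otimes> a" "j = s \<otimes> b"
        by (auto simp: cgenideal_def)
      moreover from this ab have "i \<otimes> j = (r \<otimes> s) \<otimes> (a \<otimes> b)"
        by (simp add: m_ac)
      ultimately show ?case using ab I_l_closed by simp
    qed simp
    then have "ideal_prod R (PIdl a) (PIdl b) \<subseteq> P" by (rule subsetI)
    then have "PIdl a \<subseteq> P \<or> PIdl b \<subseteq> P"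
      using P cgenideal_ideal[OF ab(1)] cgenideal_ideal[OF ab(2)]
      by (simp add: prime_two_sided_ideal_def)
    then show "a \<in> P \<or> b \<in> P"
      using cgenideal_self[OF ab(1)] cgenideal_self[OF ab(2)] by auto
  qed
next
  assume "primeideal P R"
  then interpret primeideal P R .
  have "I \<subseteq> P \<or> J \<subseteq> P" if "ideal I R" "ideal J R" "ideal_prod R I J \<subseteq> P" for I J
  proof (rule ccontr)
    assume "\<not> (I \<subseteq> P \<or> J \<subseteq> P)"
    then obtain i j where ij: "i \<in> I" "i \<notin> P" "j \<in> J" "j \<notin> P" by auto
    then have "i \<otimes> j \<in> P" using that(3) ideal_prod.prod[of i I j J R] by auto
    then show False
      using ij I_prime ideal.Icarr[OF that(1)] ideal.Icarr[OF that(2)] by auto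
  qed
  then show "prime_two_sided_ideal P R"
    using is_ideal I_notcarr by (auto simp: prime_two_sided_ideal_def)
qed

end

theory Submission
  imports Defs
begin

text \<open>The prime radical \<open>N\<close> of \<open>R\<close> is its nilradical, and \<open>P(M\<^sub>n(R)) = M\<^sub>n(N)\<close>. The cycle
  is (1) \<open>\<Rightarrow>\<close> (2) \<open>\<Rightarrow>\<close> (3) \<open>\<Rightarrow>\<close> (1), with (1) \<open>\<Rightarrow>\<close> (2) immediate since \<open>M\<^sub>2(N)\<close> is an ideal.

  (2) \<open>\<Rightarrow>\<close> (3): modulo \<open>N\<close> the matrix \<open>A\<close> is idempotent, hence so are its determinant \<open>d\<close> and, if
  \<open>d \<in> N\<close>, its trace \<open>t\<close>; as \<open>R\<close> is local, each of these lies in \<open>N\<close> or in \<open>1 + N\<close>. If \<open>d\<close> is a unit,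
  cancel \<open>A\<close> from \<open>A (1 - A) \<in> M\<^sub>2(N)\<close>. Otherwise \<open>A - A\<^sup>2 = (1 - t) A + d\<close> forces \<open>A \<in> M\<^sub>2(N)\<close> when
  \<open>1 - t\<close> is a unit. In the remaining case \<open>t\<close> is a unit and \<open>d\<close> is nilpotent, and iterating
  \<open>x \<mapsto> (x\<^sup>2 + d) / t\<close> from \<open>0\<close> reaches a root \<open>x \<in> N\<close> in finitely many steps; the other root
  is \<open>t - x\<close>.

  (3) \<open>\<Rightarrow>\<close> (1): if \<open>x \<in> N\<close> and \<open>y \<in> 1 + N\<close> are roots, then \<open>y - x\<close> is a unit, so \<open>t = x + y\<close> and
  \<open>d = x y\<close>, and by Cayley-Hamilton \<open>(A - x) / (y - x)\<close> is the required idempotent.\<close>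

section \<open>Elementwise descriptions of ideals and prime ideals\<close>

text \<open>The additive inverse of \<open>a\<close> is \<open>(- 1) * a\<close>, so absorption
  together with zero and sums already yields the subgroup condition.\<close>

lemma ideal_type_ring_iff:
  "ideal I (type_ring :: 'a::comm_ring_1 ring) \<longleftrightarrow>
     0 \<in> I \<and> (\<forall>a\<in>I. \<forall>b\<in>I. a + b \<in> I) \<and> (\<forall>a\<in>I. \<forall>x. x * a \<in> I)"
proof
  assume "ideal I (type_ring :: 'a ring)"
  then interpret ideal I "type_ring :: 'a ring" .
  show "0 \<in> I \<and> (\<forall>a\<in>I. \<forall>b\<in>I. a + b \<in> I) \<and> (\<forall>a\<in>I. \<forall>x. x * a \<in> I)"
    using additive_subgroup.zero_closed[OF is_additive_subgroup]
      additive_subgroup.a_closed[OF is_additive_subgroup] I_l_closed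
    by (auto simp: type_ring_def)
next
  assume I: "0 \<in> I \<and> (\<forall>a\<in>I. \<forall>b\<in>I. a + b \<in> I) \<and> (\<forall>a\<in>I. \<forall>x. x * a \<in> I)"
  interpret ring "type_ring :: 'a ring" by (rule ring_type_ring)
  show "ideal I (type_ring :: 'a ring)"
  proof (rule idealI[OF ring_type_ring])
    show "subgroup I (add_monoid (type_ring :: 'a ring))"
    proof (rule add.subgroupI)
      fix a assume "a \<in> I"
      moreover have "\<ominus>\<^bsub>type_ring\<^esub> a = (- 1) * a"
        by (rule minus_equality) (auto simp: type_ring_def)
      ultimately show "\<ominus>\<^bsub>type_ring\<^esub> a \<in> I" using I by metis
    qed (use I in \<open>auto simp: type_ring_def\<close>)
  qed (use I in \<open>auto simp: type_ring_def mult.commute\<close>)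
qed

lemma ideal_matrix_ring_iff:
  "ideal I (matrix_ring :: ('a::comm_ring_1 ^ 'n ^ 'n) ring) \<longleftrightarrow>
     0 \<in> I \<and> (\<forall>A\<in>I. \<forall>B\<in>I. A + B \<in> I) \<and> (\<forall>A\<in>I. \<forall>X. X ** A \<in> I \<and> A ** X \<in> I)"
proof
  assume "ideal I (matrix_ring :: ('a ^ 'n ^ 'n) ring)"
  then interpret ideal I "matrix_ring :: ('a ^ 'n ^ 'n) ring" .
  show "0 \<in> I \<and> (\<forall>A\<in>I. \<forall>B\<in>I. A + B \<in> I) \<and> (\<forall>A\<in>I. \<forall>X. X ** A \<in> I \<and> A ** X \<in> I)"
    using additive_subgroup.zero_closed[OF is_additive_subgroup]
      additive_subgroup.a_closed[OF is_additive_subgroup] I_l_closed I_r_closed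
    by (auto simp: matrix_ring_def)
next
  assume I: "0 \<in> I \<and> (\<forall>A\<in>I. \<forall>B\<in>I. A + B \<in> I) \<and> (\<forall>A\<in>I. \<forall>X. X ** A \<in> I \<and> A ** X \<in> I)"
  interpret ring "matrix_ring :: ('a ^ 'n ^ 'n) ring" by (rule ring_matrix_ring)
  show "ideal I (matrix_ring :: ('a ^ 'n ^ 'n) ring)"
  proof (rule idealI[OF ring_matrix_ring])
    show "subgroup I (add_monoid (matrix_ring :: ('a ^ 'n ^ 'n) ring))"
    proof (rule add.subgroupI)
      fix A assume "A \<in> I"
      \<comment> \<open>Negation is multiplication by a scalar matrix, hence covered by
        absorption.\<close>
      moreover have "mat (- 1) ** A + A = 0"
        by (simp add: vec_eq_iff matrix_matrix_mult_def mat_def if_distrib[where f = "\<lambda>x. x * _"]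
            sum.delta cong: if_cong)
      then have "\<ominus>\<^bsub>matrix_ring\<^esub> A = mat (- 1) ** A"
        by (intro minus_equality) (auto simp: matrix_ring_def)
      ultimately show "\<ominus>\<^bsub>matrix_ring\<^esub> A \<in> I" using I by metis
    qed (use I in \<open>auto simp: matrix_ring_def\<close>)
  qed (use I in \<open>auto simp: matrix_ring_def\<close>)
qed

lemma prime_ideal_type_ring_iff:
  "prime_two_sided_ideal P (type_ring :: 'a::comm_ring_1 ring) \<longleftrightarrow>
     ideal P (type_ring :: 'a ring) \<and> 1 \<notin> P \<and> (\<forall>a b. a * b \<in> P \<longrightarrow> a \<in> P \<or> b \<in> P)"
proof -
  have "P = UNIV \<longleftrightarrow> 1 \<in> P" if "ideal P (type_ring :: 'a ring)"
    using that unfolding ideal_type_ring_iff by (metis UNIV_I UNIV_eq_I mult.right_neutral)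
  then show ?thesis
    using cring_type_ring[where 'a = 'a]
    unfolding cring.prime_two_sided_ideal_iff_primeideal[OF cring_type_ring]
    by (auto simp: primeideal_def primeideal_axioms_def type_ring_def)
qed

section \<open>Ideals maximal among those avoiding a set, and the nilradical\<close>

text \<open>Zorn's lemma: the union of a nonempty chain of such ideals is again one. It is applied
  with \<open>S\<close> the powers of a non-nilpotent element, and with \<open>S = {1}\<close> to
  obtain maximal ideals.\<close>

lemma ideal_maximal_avoiding:
  fixes I S :: "'a::comm_ring_1 set"
  assumes "ideal I type_ring" "I \<inter> S = {}"
  obtains M where "ideal M type_ring" "I \<subseteq> M" "M \<inter> S = {}"
    "\<forall>J. ideal J type_ring \<longrightarrow> M \<subseteq> J \<longrightarrow> J \<inter> S = {} \<longrightarrow> J = M"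
proof -
  let ?F = "{J. ideal J (type_ring :: 'a ring) \<and> I \<subseteq> J \<and> J \<inter> S = {}}"
  have "\<exists>M\<in>?F. \<forall>X\<in>?F. M \<subseteq> X \<longrightarrow> X = M"
  proof (rule subset_Zorn_nonempty)
    show "?F \<noteq> {}" using assms by auto
    fix C assume C: "C \<noteq> {}" "subset.chain ?F C"
    then have mem: "\<And>J. J \<in> C \<Longrightarrow> ideal J (type_ring :: 'a ring) \<and> I \<subseteq> J \<and> J \<inter> S = {}"
      and tot: "\<And>J K. J \<in> C \<Longrightarrow> K \<in> C \<Longrightarrow> J \<subseteq> K \<or> K \<subseteq> J"
      by (auto simp: subset_chain_def)
    have "ideal (\<Union>C) (type_ring :: 'a ring)"
      unfolding ideal_type_ring_iff
    proof (intro conjI ballI allI)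
      show "0 \<in> \<Union>C" using C(1) mem by (force simp: ideal_type_ring_iff)
      show "x * a \<in> \<Union>C" if "a \<in> \<Union>C" for a x
      proof -
        obtain J where "J \<in> C" "a \<in> J" using \<open>a \<in> \<Union>C\<close> by auto
        moreover from this have "x * a \<in> J" using mem[of J] by (auto simp: ideal_type_ring_iff)
        ultimately show ?thesis by blast
      qed
      fix a b assume "a \<in> \<Union>C" "b \<in> \<Union>C"
      then obtain J K where "J \<in> C" "K \<in> C" "a \<in> J" "b \<in> K" by auto
      with tot obtain L where "L \<in> C" "a \<in> L" "b \<in> L" by blast
      moreover from this have "a + b \<in> L" using mem[of L] by (auto simp: ideal_type_ring_iff)
      ultimately show "a + b \<in> \<Union>C" by blast
    qed
    then show "\<Union>C \<in> ?F" using C(1) mem by blast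
  qed
  then obtain M where M: "M \<in> ?F" and max: "\<forall>X\<in>?F. M \<subseteq> X \<longrightarrow> X = M" by (rule bexE)
  show thesis
  proof (rule that)
    show "\<forall>J. ideal J type_ring \<longrightarrow> M \<subseteq> J \<longrightarrow> J \<inter> S = {} \<longrightarrow> J = M"
      using M max[rule_format] by auto
  qed (use M in auto)
qed

text \<open>This is the ideal generated by \<open>I\<close> and \<open>a\<close>, the enlargement
  against which maximality is tested.\<close>

lemma ideal_adjoin:
  fixes I :: "'a::comm_ring_1 set"
  assumes "ideal I type_ring"
  shows "ideal {m + r * a |m r. m \<in> I} type_ring"
  unfolding ideal_type_ring_iff
proof (intro conjI ballI allI)
  have I: "0 \<in> I" "\<And>x y. x \<in> I \<Longrightarrow> y \<in> I \<Longrightarrow> x + y \<in> I" "\<And>x r. x \<in> I \<Longrightarrow> r * x \<in> I"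
    using assms by (auto simp: ideal_type_ring_iff)
  show "0 \<in> {m + r * a |m r. m \<in> I}"
    using I(1) by (intro CollectI exI[of _ 0]) simp
  fix x assume "x \<in> {m + r * a |m r. m \<in> I}"
  then obtain m r where x: "x = m + r * a" "m \<in> I" by blast
  show "s * x \<in> {m + r * a |m r. m \<in> I}" for s
    using x I(3) by (intro CollectI exI[of _ "s * m"] exI[of _ "s * r"]) (simp add: algebra_simps)
  fix y assume "y \<in> {m + r * a |m r. m \<in> I}"
  then obtain m' r' where y: "y = m' + r' * a" "m' \<in> I" by blast
  show "x + y \<in> {m + r * a |m r. m \<in> I}"
    using x y I(2)
    by (intro CollectI exI[of _ "m + m'"] exI[of _ "r + r'"]) (simp add: algebra_simps)
qed

text \<open>If \<open>a\<close> and \<open>b\<close> lie outside \<open>M\<close>, adjoining either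
  one makes the ideal meet \<open>S\<close>. The product of the two elements found is in
  \<open>S\<close>, and \<open>a * b \<in> M\<close> would put it in \<open>M\<close> as
  well.\<close>

lemma prime_ideal_maximal_avoiding:
  fixes M S :: "'a::comm_ring_1 set"
  assumes M: "ideal M type_ring" "M \<inter> S = {}"
    and max: "\<And>J. ideal J type_ring \<Longrightarrow> M \<subseteq> J \<Longrightarrow> J \<inter> S = {} \<Longrightarrow> J = M"
    and S: "1 \<in> S" "\<And>s t. s \<in> S \<Longrightarrow> t \<in> S \<Longrightarrow> s * t \<in> S"
  shows "prime_two_sided_ideal M type_ring"
  unfolding prime_ideal_type_ring_iff
proof (intro conjI allI impI)
  have I: "0 \<in> M" "\<And>x y. x \<in> M \<Longrightarrow> y \<in> M \<Longrightarrow> x + y \<in> M" "\<And>x r. x \<in> M \<Longrightarrow> r * x \<in> M"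
    using M(1) by (auto simp: ideal_type_ring_iff)
  show "ideal M type_ring" by fact
  show "1 \<notin> M" using M(2) S(1) by auto
  fix a b assume ab: "a * b \<in> M"
  have meets: "\<exists>m r. m \<in> M \<and> m + r * c \<in> S" if "c \<notin> M" for c
  proof -
    let ?J = "{m + r * c |m r. m \<in> M}"
    have "M \<subseteq> ?J"
    proof
      fix m assume "m \<in> M"
      then show "m \<in> ?J" by (intro CollectI exI[of _ m] exI[of _ 0]) simp
    qed
    moreover have "c \<in> ?J" using I(1) by (intro CollectI exI[of _ 0] exI[of _ 1]) simp
    ultimately have "?J \<inter> S \<noteq> {}" using max[OF ideal_adjoin[OF M(1)], of c] that by blast
    then show ?thesis by blast
  qed
  show "a \<in> M \<or> b \<in> M"
  proof (rule ccontr)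
    assume "\<not> (a \<in> M \<or> b \<in> M)"
    then obtain m r m' r' where *: "m \<in> M" "m + r * a \<in> S" "m' \<in> M" "m' + r' * b \<in> S"
      using meets by blast
    \<comment> \<open>The expansion is grouped so that each summand is a multiple of
      \<open>m\<close>, \<open>m'\<close> or \<open>a * b\<close>.\<close>
    have "(m + r * a) * (m' + r' * b) = (m' + r' * b) * m + (r * a) * m' + (r * r') * (a * b)"
      by (simp add: algebra_simps)
    also have "\<dots> \<in> M" by (rule I(2)[OF I(2)[OF I(3)[OF *(1)] I(3)[OF *(3)]] I(3)[OF ab]])
    finally show False using S(2)[OF *(2,4)] M(2) by blast
  qed
qed

lemma prime_radical_type_ring_iff:
  "x \<in> prime_radical (type_ring :: 'a::comm_ring_1 ring) \<longleftrightarrow>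
     (\<forall>P. prime_two_sided_ideal P (type_ring :: 'a ring) \<longrightarrow> x \<in> P)"
  by (auto simp: prime_radical_def type_ring_def)

text \<open>If \<open>x\<close> is not nilpotent, an ideal maximal among those avoiding the powers
  of \<open>x\<close> is prime and omits \<open>x\<close>. Conversely, a prime ideal contains
  \<open>0 = x ^ n\<close> and hence \<open>x\<close>.\<close>

lemma prime_radical_eq_nilradical:
  "prime_radical (type_ring :: 'a::comm_ring_1 ring) = {x. \<exists>n. x ^ n = 0}"
proof (intro Set.equalityI subsetI CollectI)
  fix x :: 'a assume x: "x \<in> prime_radical type_ring"
  show "\<exists>n. x ^ n = 0"
  proof (rule ccontr)
    assume "\<nexists>n. x ^ n = 0"
    then have avoid: "{0} \<inter> range ((^) x) = {}" by auto
    have "ideal {0} (type_ring :: 'a ring)" by (simp add: ideal_type_ring_iff)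
    then obtain M where M: "ideal M (type_ring :: 'a ring)" "{0} \<subseteq> M" "M \<inter> range ((^) x) = {}"
      "\<forall>J. ideal J type_ring \<longrightarrow> M \<subseteq> J \<longrightarrow> J \<inter> range ((^) x) = {} \<longrightarrow> J = M"
      using avoid by (rule ideal_maximal_avoiding)
    have "prime_two_sided_ideal M type_ring"
    proof (rule prime_ideal_maximal_avoiding[OF M(1,3)])
      show "J = M" if "ideal J type_ring" "M \<subseteq> J" "J \<inter> range ((^) x) = {}" for J
        using M(4) that by blast
      show "1 \<in> range ((^) x)" by (rule range_eqI[of _ _ 0]) simp
      show "s * t \<in> range ((^) x)" if "s \<in> range ((^) x)" "t \<in> range ((^) x)" for s t
        using that by (auto simp flip: power_add)
    qed
    then have "x \<in> M" using x by (simp add: prime_radical_type_ring_iff)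
    moreover have "x \<in> range ((^) x)" by (rule range_eqI[of _ _ 1]) simp
    ultimately show False using M(3) by blast
  qed
next
  fix x :: 'a assume "x \<in> {x. \<exists>n. x ^ n = 0}"
  then obtain n where n: "x ^ n = 0" by auto
  show "x \<in> prime_radical type_ring"
    unfolding prime_radical_type_ring_iff
  proof (intro allI impI)
    fix P assume "prime_two_sided_ideal P (type_ring :: 'a ring)"
    then have P: "0 \<in> P" "1 \<notin> P" "\<And>a b. a * b \<in> P \<Longrightarrow> a \<in> P \<or> b \<in> P"
      by (auto simp: prime_ideal_type_ring_iff ideal_type_ring_iff)
    \<comment> \<open>One factor is split off at a time; the base case is vacuous because
      \<open>x ^ 0 = 1\<close> is not in \<open>P\<close>.\<close>
    have "x ^ k \<in> P \<Longrightarrow> x \<in> P" for k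
      by (induction k) (use P in auto)
    then show "x \<in> P" using n P(1) by metis
  qed
qed

lemma ideal_prime_radical: "ideal (prime_radical type_ring) (type_ring :: 'a::comm_ring_1 ring)"
  unfolding ideal_type_ring_iff
  by (auto simp: prime_radical_type_ring_iff prime_ideal_type_ring_iff ideal_type_ring_iff)

section \<open>Units in a local ring\<close>

text \<open>Every nonunit lies in a maximal ideal. If \<open>r\<close> and \<open>1 - r\<close> were
  both nonunits, the unique maximal ideal would contain their sum \<open>1\<close>.\<close>

lemma local_cring_unit_or_unit:
  fixes r :: "'a::comm_ring_1"
  assumes "local_cring (type_ring :: 'a ring)"
  shows "r dvd 1 \<or> (1 - r) dvd 1"
proof (rule ccontr)
  assume nonunits: "\<not> (r dvd 1 \<or> (1 - r) dvd 1)"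
  have ex: "\<exists>M. maximalideal M (type_ring :: 'a ring) \<and> c \<in> M" if "\<not> c dvd 1" for c :: 'a
  proof -
    \<comment> \<open>The principal ideal of a nonunit omits \<open>1\<close>, so it extends to an
      ideal maximal among those omitting \<open>1\<close>.\<close>
    have "ideal {x. c dvd x} (type_ring :: 'a ring)"
      by (auto simp: ideal_type_ring_iff)
    moreover have "{x. c dvd x} \<inter> {1} = {}" using that by auto
    ultimately obtain M where M: "ideal M (type_ring :: 'a ring)" "{x. c dvd x} \<subseteq> M" "M \<inter> {1} = {}"
      "\<forall>J. ideal J type_ring \<longrightarrow> M \<subseteq> J \<longrightarrow> J \<inter> {1} = {} \<longrightarrow> J = M"
      by (rule ideal_maximal_avoiding)
    have "maximalideal M (type_ring :: 'a ring)"
    proof (rule maximalidealI[OF M(1)])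
      show "carrier type_ring \<noteq> M" using M(3) by (auto simp: type_ring_def)
      fix J assume J: "ideal J (type_ring :: 'a ring)" "M \<subseteq> J"
      have "J = UNIV" if "1 \<in> J"
        using J(1) that by (metis UNIV_eq_I ideal_type_ring_iff mult.right_neutral)
      then show "J = M \<or> J = carrier type_ring" using M(4) J by (auto simp: type_ring_def)
    qed
    moreover have "c \<in> M" using M(2) by auto
    ultimately show ?thesis by blast
  qed
  with nonunits assms obtain M where M: "maximalideal M (type_ring :: 'a ring)" "r \<in> M" "1 - r \<in> M"
    unfolding local_cring_def by metis
  then interpret maximalideal M "type_ring :: 'a ring" by simp
  have "r + (1 - r) \<in> M" using M is_ideal unfolding ideal_type_ring_iff by blast
  then have "1 \<in> M" by simp
  then have "x * 1 \<in> M" for x using is_ideal unfolding ideal_type_ring_iff by blast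
  then show False using I_notcarr by (auto simp: type_ring_def)
qed

section \<open>The prime radical of a matrix ring\<close>

lemma mat_mult_nth: "(mat k ** A) $ i $ j = k * A $ i $ j" for A :: "'a::comm_ring_1 ^ 'n ^ 'n"
  by (simp add: matrix_matrix_mult_def mat_def if_distrib[where f = "\<lambda>x. x * _"] sum.delta cong: if_cong)

lemma mult_mat_nth: "(A ** mat k) $ i $ j = k * A $ i $ j" for A :: "'a::comm_ring_1 ^ 'n ^ 'n"
  by (simp add: matrix_matrix_mult_def mat_def if_distrib[where f = "\<lambda>x. _ * x"] sum.delta mult.commute cong: if_cong)

lemma mat_mult_commute: "mat k ** A = A ** mat k" for A :: "'a::comm_ring_1 ^ 'n ^ 'n"
  by (simp add: vec_eq_iff mat_mult_nth mult_mat_nth)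

lemma mat_mult_mat: "mat a ** mat b = (mat (a * b) :: 'a::comm_ring_1 ^ 'n ^ 'n)"
  by (simp add: vec_eq_iff mat_mult_nth) (simp add: mat_def)

lemma ideal_sum_mem:
  fixes I :: "'a::comm_ring_1 set"
  assumes "ideal I type_ring" "\<And>i. i \<in> T \<Longrightarrow> f i \<in> I"
  shows "sum f T \<in> I"
  using assms(2) by (induction T rule: infinite_finite_induct)
    (use assms(1) in \<open>auto simp: ideal_type_ring_iff\<close>)

lemma ideal_sum_mem_matrix:
  fixes I :: "('a::comm_ring_1 ^ 'n ^ 'n) set"
  assumes "ideal I matrix_ring" "\<And>i. i \<in> T \<Longrightarrow> f i \<in> I"
  shows "sum f T \<in> I"
  using assms(2) by (induction T rule: infinite_finite_induct)
    (use assms(1) in \<open>auto simp: ideal_matrix_ring_iff\<close>)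

lemma ideal_matrices_over:
  fixes I :: "'a::comm_ring_1 set"
  assumes "ideal I type_ring"
  shows "ideal (matrices_over I) (matrix_ring :: ('a ^ 'n ^ 'n) ring)"
  unfolding ideal_matrix_ring_iff
proof (intro conjI ballI allI)
  have I: "0 \<in> I" "\<And>x y. x \<in> I \<Longrightarrow> y \<in> I \<Longrightarrow> x + y \<in> I" "\<And>x r. x \<in> I \<Longrightarrow> r * x \<in> I"
    "\<And>x r. x \<in> I \<Longrightarrow> x * r \<in> I"
    using assms by (auto simp: ideal_type_ring_iff mult.commute)
  show "0 \<in> (matrices_over I :: ('a ^ 'n ^ 'n) set)" using I by (simp add: matrices_over_def)
  fix A :: "'a ^ 'n ^ 'n" assume A: "A \<in> matrices_over I"
  show "A + B \<in> matrices_over I" if "B \<in> matrices_over I" for B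
    using A that I by (simp add: matrices_over_def)
  show "X ** A \<in> matrices_over I" "A ** X \<in> matrices_over I" for X
    using A I by (auto simp: matrices_over_def matrix_matrix_mult_def intro!: ideal_sum_mem[OF assms])
qed

text \<open>The standard matrix unit, usually written \<open>E_kl\<close>.\<close>

definition matrix_unit :: "'n \<Rightarrow> 'n \<Rightarrow> 'a::comm_ring_1 ^ 'n ^ 'n" where
  "matrix_unit k l = (\<chi> i j. if i = k \<and> j = l then 1 else 0)"

text \<open>A matrix unit between two factors isolates the product of a single entry of each, which
  links products of ideals to products of entries.\<close>

lemma mult_matrix_unit_mult_nth:
  "(A ** matrix_unit k l ** B) $ i $ j = A $ i $ k * B $ l $ j"
  for A B :: "'a::comm_ring_1 ^ 'n ^ 'n"
proof -
  have "(A ** matrix_unit k l) $ i $ m = (if m = l then A $ i $ k else 0)" for m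
    by (simp add: matrix_matrix_mult_def matrix_unit_def if_distrib[where f = "\<lambda>x. _ * x"] sum.delta
        cong: if_cong)
  then show ?thesis
    by (subst matrix_matrix_mult_def)
      (simp add: if_distrib[where f = "\<lambda>x. x * _"] sum.delta cong: if_cong)
qed

text \<open>If \<open>A \<in> I\<close> and \<open>B \<in> J\<close> each have an entry outside
  \<open>P\<close>, a suitable matrix unit between them gives an element of the ideal product having
  the product of these entries as an entry, and that is outside \<open>P\<close>.\<close>

lemma prime_ideal_matrices_over:
  fixes P :: "'a::comm_ring_1 set"
  assumes P: "prime_two_sided_ideal P type_ring"
  shows "prime_two_sided_ideal (matrices_over P) (matrix_ring :: ('a ^ 'n ^ 'n) ring)"
  unfolding prime_two_sided_ideal_def
proof (intro conjI allI impI)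
  have P': "ideal P type_ring" "1 \<notin> P" "\<And>a b. a * b \<in> P \<Longrightarrow> a \<in> P \<or> b \<in> P"
    using P by (auto simp: prime_ideal_type_ring_iff)
  show "ideal (matrices_over P) (matrix_ring :: ('a ^ 'n ^ 'n) ring)"
    using P'(1) by (rule ideal_matrices_over)
  have "mat 1 \<notin> (matrices_over P :: ('a ^ 'n ^ 'n) set)"
    using P'(2) by (auto simp: matrices_over_def mat_def)
  then show "matrices_over P \<noteq> carrier (matrix_ring :: ('a ^ 'n ^ 'n) ring)"
    by (auto simp: matrix_ring_def)
  fix I J :: "('a ^ 'n ^ 'n) set"
  assume IJ: "ideal I matrix_ring" "ideal J matrix_ring" "ideal_prod matrix_ring I J \<subseteq> matrices_over P"
  show "I \<subseteq> matrices_over P \<or> J \<subseteq> matrices_over P"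
  proof (rule ccontr)
    assume "\<not> (I \<subseteq> matrices_over P \<or> J \<subseteq> matrices_over P)"
    then obtain A B i j k l where *: "A \<in> I" "A $ i $ j \<notin> P" "B \<in> J" "B $ k $ l \<notin> P"
      unfolding matrices_over_def by blast
    have "A ** matrix_unit j k \<in> I" using *(1) IJ(1) by (auto simp: ideal_matrix_ring_iff)
    from ideal_prod.prod[OF this *(3), of matrix_ring]
    have "A ** matrix_unit j k ** B \<in> matrices_over P"
      using IJ(3) by (auto simp: matrix_ring_def)
    then have "A $ i $ j * B $ k $ l \<in> P"
      by (auto simp: matrices_over_def mult_matrix_unit_mult_nth dest: spec[of _ i] spec[of _ l])
    then show False using P'(3) * by blast
  qed
qed

text \<open>Scalar matrices are central, so the multiples of \<open>mat a\<close> and of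
  \<open>mat b\<close> form two-sided ideals. Their product consists of multiples of
  \<open>mat (a * b)\<close>, so primeness of \<open>Q\<close> can be applied to these two
  ideals.\<close>

lemma prime_ideal_scalars:
  fixes Q :: "('a::comm_ring_1 ^ 'n ^ 'n) set"
  assumes Q: "prime_two_sided_ideal Q matrix_ring"
  shows "prime_two_sided_ideal {a. mat a \<in> Q} type_ring"
  unfolding prime_ideal_type_ring_iff ideal_type_ring_iff
proof (intro conjI ballI allI impI)
  have idl: "ideal Q matrix_ring" and ne: "Q \<noteq> UNIV"
    and pr: "\<And>I J. ideal I matrix_ring \<Longrightarrow> ideal J matrix_ring \<Longrightarrow> ideal_prod matrix_ring I J \<subseteq> Q
      \<Longrightarrow> I \<subseteq> Q \<or> J \<subseteq> Q"
    using Q by (auto simp: prime_two_sided_ideal_def matrix_ring_def)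
  have I: "0 \<in> Q" "\<And>A B. A \<in> Q \<Longrightarrow> B \<in> Q \<Longrightarrow> A + B \<in> Q" "\<And>A X. A \<in> Q \<Longrightarrow> X ** A \<in> Q"
    "\<And>A X. A \<in> Q \<Longrightarrow> A ** X \<in> Q"
    using idl by (auto simp: ideal_matrix_ring_iff)
  show "0 \<in> {a. mat a \<in> Q}" using I(1) by (simp add: mat_0)
  show "a + b \<in> {a. mat a \<in> Q}" if "a \<in> {a. mat a \<in> Q}" "b \<in> {a. mat a \<in> Q}" for a b
  proof -
    have "mat (a + b) = (mat a + mat b :: 'a ^ 'n ^ 'n)" by (simp add: mat_def vec_eq_iff)
    then show ?thesis using that I(2) by simp
  qed
  show "x * a \<in> {a. mat a \<in> Q}" if "a \<in> {a. mat a \<in> Q}" for a x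
    using that I(3) by (auto simp flip: mat_mult_mat)
  show "1 \<notin> {a. mat a \<in> Q}" using I(3) ne by (metis UNIV_eq_I matrix_mul_rid mem_Collect_eq)
  fix a b assume ab: "a * b \<in> {a. mat a \<in> Q}"
  have scalar_ideal: "ideal (range ((**) (mat c))) (matrix_ring :: ('a ^ 'n ^ 'n) ring)" for c
    unfolding ideal_matrix_ring_iff
  proof (intro conjI ballI allI)
    show "0 \<in> range ((**) (mat c :: 'a ^ 'n ^ 'n))" by (rule range_eqI[of _ _ 0]) simp
    fix A :: "'a ^ 'n ^ 'n" assume "A \<in> range ((**) (mat c))"
    then obtain Y where A: "A = mat c ** Y" by auto
    fix X :: "'a ^ 'n ^ 'n"
    show "A ** X \<in> range ((**) (mat c))"
      by (rule range_eqI[of _ _ "Y ** X"]) (simp add: A matrix_mul_assoc)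
    show "X ** A \<in> range ((**) (mat c))"
      by (rule range_eqI[of _ _ "X ** Y"]) (metis A matrix_mul_assoc mat_mult_commute)
  next
    fix A B :: "'a ^ 'n ^ 'n" assume "A \<in> range ((**) (mat c))" "B \<in> range ((**) (mat c))"
    then obtain Y Z where "A = mat c ** Y" "B = mat c ** Z" by auto
    then show "A + B \<in> range ((**) (mat c))"
      by (intro range_eqI[of _ _ "Y + Z"]) (simp add: matrix_add_ldistrib)
  qed
  have "ideal_prod matrix_ring (range ((**) (mat a))) (range ((**) (mat b))) \<subseteq> Q"
  proof
    fix X assume "X \<in> ideal_prod matrix_ring (range ((**) (mat a))) (range ((**) (mat b :: 'a ^ 'n ^ 'n)))"
    then show "X \<in> Q"
    proof induction
      case (prod A B)
      then obtain Y Z where "A = mat a ** Y" "B = mat b ** Z" by auto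
      then have "A ** B = mat (a * b) ** (Y ** Z)"
        by (metis matrix_mul_assoc mat_mult_commute mat_mult_mat)
      then show ?case using ab I(4) by (simp add: matrix_ring_def)
    next
      case (sum A B)
      then show ?case using I(2) by (simp add: matrix_ring_def)
    qed
  qed
  from pr[OF scalar_ideal scalar_ideal this]
  show "a \<in> {a. mat a \<in> Q} \<or> b \<in> {a. mat a \<in> Q}"
    by (metis (no_types, lifting) matrix_mul_rid mem_Collect_eq rangeI subsetD)
qed

text \<open>Primes \<open>P\<close> of the base ring give primes \<open>matrices_over P\<close>,
  which bounds the radical from above. For the other inclusion, the scalars in a prime
  \<open>Q\<close> form a prime ideal containing all entries of \<open>A\<close>, and
  \<open>A\<close> is rebuilt from these scalars and matrix units.\<close>

lemma prime_radical_matrix_ring: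
  "prime_radical (matrix_ring :: ('a::comm_ring_1 ^ 'n ^ 'n) ring) =
     matrices_over (prime_radical type_ring)"
proof (intro Set.equalityI subsetI)
  fix A :: "'a ^ 'n ^ 'n" assume "A \<in> prime_radical matrix_ring"
  then have "A \<in> matrices_over P" if "prime_two_sided_ideal P type_ring" for P
    using prime_ideal_matrices_over[OF that] by (auto simp: prime_radical_def)
  then show "A \<in> matrices_over (prime_radical type_ring)"
    by (auto simp: matrices_over_def prime_radical_type_ring_iff)
next
  fix A :: "'a ^ 'n ^ 'n" assume A: "A \<in> matrices_over (prime_radical type_ring)"
  have "A \<in> Q" if Q: "prime_two_sided_ideal Q matrix_ring" for Q
  proof -
    have idl: "ideal Q matrix_ring" using Q by (simp add: prime_two_sided_ideal_def)
    have "mat (A $ i $ j) \<in> Q" for i j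
      using A prime_ideal_scalars[OF Q] by (auto simp: matrices_over_def prime_radical_type_ring_iff)
    then have "(\<Sum>i\<in>UNIV. \<Sum>j\<in>UNIV. mat (A $ i $ j) ** matrix_unit i j) \<in> Q"
      using idl by (intro ideal_sum_mem_matrix[OF idl]) (auto simp: ideal_matrix_ring_iff)
    also have "(\<Sum>i\<in>UNIV. \<Sum>j\<in>UNIV. mat (A $ i $ j) ** matrix_unit i j) = A"
    proof -
      have "(\<Sum>i\<in>UNIV. \<Sum>j\<in>UNIV. A $ i $ j * (if k = i \<and> l = j then 1 else 0)) = A $ k $ l" for k l
      proof -
        have "(\<Sum>j\<in>UNIV. A $ i $ j * (if k = i \<and> l = j then 1 else 0)) = (if k = i then A $ i $ l else 0)" for i
          by (cases "k = i") (simp_all add: if_distrib[where f = "\<lambda>x. _ * x"] cong: if_cong)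
        then show ?thesis by simp
      qed
      then show ?thesis by (simp add: vec_eq_iff mat_mult_nth matrix_unit_def)
    qed
    finally show ?thesis .
  qed
  then show "A \<in> prime_radical matrix_ring" by (auto simp: prime_radical_def matrix_ring_def)
qed

section \<open>Nilpotent elements and quadratic equations\<close>

text \<open>The geometric series in \<open>- x\<close> terminates and gives the inverse.\<close>

lemma one_plus_nilpotent_unit:
  fixes x :: "'a::comm_ring_1"
  assumes "x ^ n = 0"
  shows "(1 + x) dvd 1"
proof -
  have "1 - (- x) ^ n = (1 - (- x)) * (\<Sum>i<n. (- x) ^ i)" by (rule one_diff_power_eq)
  moreover have "(- x) ^ n = 0" using assms by (simp add: power_minus[of x])
  ultimately show ?thesis by (metis add_uminus_conv_diff diff_zero dvdI minus_minus)
qed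

text \<open>Each iteration gains one factor \<open>d\<close> in the value of the quadratic, so after
  \<open>n\<close> steps that value is zero. Divisibility of the iterate by \<open>d\<close> is
  carried along, both to gain the factor and to make the root nilpotent.\<close>

lemma quadratic_root_of_nilpotent:
  fixes t d :: "'a::comm_ring_1"
  assumes "t dvd 1" "d ^ n = 0"
  obtains x where "d dvd x" "x\<^sup>2 - t * x + d = 0"
proof -
  obtain s where s: "t * s = 1" using assms(1) by (auto simp: dvd_def)
  have "\<exists>x. d dvd x \<and> d ^ k dvd x\<^sup>2 - t * x + d" for k
  proof (induction k)
    case 0
    show ?case by (intro exI[of _ 0]) simp
  next
    case (Suc k)
    then obtain x where x: "d dvd x" "d ^ k dvd x\<^sup>2 - t * x + d" by blast
    define x' where "x' = s * (x\<^sup>2 + d)"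
    have tx': "t * x' = x\<^sup>2 + d" using s by (simp add: x'_def mult.assoc[symmetric])
    have dx': "d dvd x'" unfolding x'_def using x(1) by (simp add: power2_eq_square)
    have "x' - x = s * (x\<^sup>2 - t * x + d)"
    proof -
      have "s * (x\<^sup>2 - t * x + d) = x' - (t * s) * x" by (simp add: x'_def algebra_simps)
      then show ?thesis using s by simp
    qed
    then have "d ^ k dvd x' - x" using x(2) by simp
    moreover have "d dvd x' + x" using dx' x(1) by simp
    ultimately have "d * d ^ k dvd (x' + x) * (x' - x)" by (rule mult_dvd_mono[rotated])
    \<comment> \<open>Since \<open>t * x'\<close> equals \<open>x\<^sup>2 + d\<close>, the new value
      of the quadratic is a difference of two squares.\<close>
    also have "(x' + x) * (x' - x) = x'\<^sup>2 - t * x' + d"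
      unfolding tx' by (simp add: power2_eq_square algebra_simps)
    finally show ?case using dx' by auto
  qed
  from this[of n] show thesis using that assms(2) by auto
qed

section \<open>Two-by-two matrices and the equivalence\<close>

lemma matrices_over_2_iff:
  "A \<in> matrices_over X \<longleftrightarrow> A $ 1 $ 1 \<in> X \<and> A $ 1 $ 2 \<in> X \<and> A $ 2 $ 1 \<in> X \<and> A $ 2 $ 2 \<in> X"
  for A :: "'a ^ 2 ^ 2"
  by (auto simp: matrices_over_def forall_2)

lemma trace_2: "trace A = A $ 1 $ 1 + A $ 2 $ 2" for A :: "'a::comm_ring_1 ^ 2 ^ 2"
  by (simp add: trace_def sum_2)

lemma matrix_mult_2_nth: "(A ** B) $ i $ j = A $ i $ 1 * B $ 1 $ j + A $ i $ 2 * B $ 2 $ j"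
  for A B :: "'a::comm_ring_1 ^ 2 ^ 2"
  by (simp add: matrix_matrix_mult_def sum_2)

lemma matrix_add_rdistrib: "(A + B) ** C = A ** C + B ** C"
  for A B C :: "'a::comm_ring_1 ^ 'n ^ 'n"
  by (simp add: vec_eq_iff matrix_matrix_mult_def distrib_right sum.distrib)

text \<open>Idempotence of \<open>E\<close> leaves \<open>W - E ** W - W ** A\<close>, a sum of
  multiples of \<open>W\<close>. Signs are written as factors \<open>mat (- 1)\<close> so that the
  ideal closure rules apply directly.\<close>

lemma strongly_P_clean_imp_diff_square:
  fixes A :: "'a::comm_ring_1 ^ 'n ^ 'n"
  assumes "strongly_P_clean matrix_ring A"
  shows "A - A ** A \<in> matrices_over (prime_radical type_ring)"
proof -
  obtain E W where EW: "E ** E = E" "W \<in> matrices_over (prime_radical type_ring)" "A = E + W"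
    using assms by (auto simp: strongly_P_clean_def prime_radical_matrix_ring)
      (auto simp: matrix_ring_def)
  have "A - A ** A = W + ((mat (- 1) ** E) ** W + W ** (mat (- 1) ** A))"
  proof -
    have neg: "mat (- 1) ** X = - X" for X :: "'a ^ 'n ^ 'n" by (simp add: vec_eq_iff mat_mult_nth)
    have "A ** A = E + E ** W + W ** A"
      by (simp add: EW matrix_add_ldistrib matrix_add_rdistrib algebra_simps)
    moreover have "(- E) ** W = - (E ** W)" by (metis neg matrix_mul_assoc)
    moreover have "W ** (- A) = - (W ** A)" by (metis neg matrix_mul_assoc mat_mult_commute)
    ultimately show ?thesis by (simp add: neg EW(3))
  qed
  then show ?thesis
    using EW(2) ideal_matrices_over[OF ideal_prime_radical, where 'n = 'n]
    unfolding ideal_matrix_ring_iff by metis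
qed

theorem theorem4p4:
  fixes A :: "'a::comm_ring_1 ^ 2 ^ 2"
  assumes "local_cring (type_ring :: 'a ring)"
  shows "(strongly_P_clean matrix_ring A \<longleftrightarrow> A - A ** A \<in> matrices_over (prime_radical type_ring)) \<and>
         (A - A ** A \<in> matrices_over (prime_radical type_ring) \<longleftrightarrow>
            A \<in> matrices_over (prime_radical type_ring) \<or> mat 1 - A \<in> matrices_over (prime_radical type_ring) \<or>
            ((\<exists>x. x \<in> prime_radical type_ring \<and> x\<^sup>2 - trace A * x + det A = 0) \<and>
             (\<exists>y. y \<in> (+) 1 ` prime_radical type_ring \<and> y\<^sup>2 - trace A * y + det A = 0)))"
proof -
  define N where "N = prime_radical (type_ring :: 'a ring)"
  have N0: "0 \<in> N" and Nadd: "\<And>x y. x \<in> N \<Longrightarrow> y \<in> N \<Longrightarrow> x + y \<in> N"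
    and Nmul: "\<And>x r. x \<in> N \<Longrightarrow> r * x \<in> N"
    using ideal_prime_radical[where 'a = 'a] by (auto simp: ideal_type_ring_iff N_def)
  have Nmul': "x * r \<in> N" if "x \<in> N" for x r using Nmul[OF that] by (simp add: mult.commute)
  have Nneg: "- x \<in> N" if "x \<in> N" for x using Nmul[OF that, of "- 1"] by simp
  have Nsub: "x - y \<in> N" if "x \<in> N" "y \<in> N" for x y using Nadd[OF that(1) Nneg[OF that(2)]] by simp
  note Ncl = N0 Nadd Nmul Nmul' Nneg Nsub
  have Nnil: "x \<in> N \<Longrightarrow> \<exists>n. x ^ n = 0" for x by (simp add: N_def prime_radical_eq_nilradical)
  have Ncancel: "x \<in> N" if u: "u dvd 1" and ux: "u * x \<in> N" for u x
  proof -
    obtain v where v: "u * v = 1" using u by (auto simp: dvd_def)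
    have "v * (u * x) = (u * v) * x" by (simp only: ac_simps)
    then show ?thesis using Nmul[OF ux, of v] v by simp
  qed
  define a b c e where abce: "a = A $ 1 $ 1" "b = A $ 1 $ 2" "c = A $ 2 $ 1" "e = A $ 2 $ 2"
  define t d where td: "t = trace A" "d = det A"
  have t: "t = a + e" and d: "d = a * e - b * c" by (simp_all add: td trace_2 det_2 abce)

  have roots: "A \<in> matrices_over N \<or> mat 1 - A \<in> matrices_over N \<or>
      ((\<exists>x. x \<in> N \<and> x\<^sup>2 - t * x + d = 0) \<and> (\<exists>y. y \<in> (+) 1 ` N \<and> y\<^sup>2 - t * y + d = 0))"
    if "A - A ** A \<in> matrices_over N"
  proof -
    \<comment> \<open>These are the entries of \<open>A - A ** A\<close>, row by row.\<close>
    define n1 n2 n3 n4 where n_def: "n1 = a - (a * a + b * c)" "n2 = b - (a * b + b * e)"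
      "n3 = c - (c * a + e * c)" "n4 = e - (c * b + e * e)"
    have n: "n1 \<in> N" "n2 \<in> N" "n3 \<in> N" "n4 \<in> N"
      using that by (simp_all add: matrices_over_2_iff matrix_mult_2_nth abce n_def)
    \<comment> \<open>This expands \<open>det A - det (A ** A)\<close>, with the entries of
      \<open>A ** A\<close> written as those of \<open>A\<close> minus the \<open>n1\<close>, ...,
      \<open>n4\<close>.\<close>
    have "d * (1 - d) = n1 * e + n4 * (a - n1) - n2 * c - n3 * (b - n2)"
      by (simp add: n_def d algebra_simps)
    then have dN: "d * (1 - d) \<in> N" using n by (simp add: Ncl)
    consider "d dvd 1" | "(1 - d) dvd 1" using local_cring_unit_or_unit[OF assms] by blast
    then show ?thesis
    proof cases
      case 1
      \<comment> \<open>Multiplying \<open>A - A ** A\<close> on the left by the adjugate of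
        \<open>A\<close> gives \<open>d\<close> times \<open>mat 1 - A\<close>; these are the
        entries, up to sign.\<close>
      have "d * (1 - a) = e * n1 - b * n3" "d * b = b * n4 - e * n2"
        "d * c = c * n1 - a * n3" "d * (1 - e) = a * n4 - c * n2"
        by (simp_all add: n_def d algebra_simps)
      then have "1 - a \<in> N" "b \<in> N" "c \<in> N" "1 - e \<in> N"
        using Ncancel[OF 1] n by (metis Nmul Nsub)+
      then have "mat 1 - A \<in> matrices_over N"
        by (simp add: matrices_over_2_iff mat_def abce Nneg)
      then show ?thesis by blast
    next
      case 2
      then have dN: "d \<in> N" using dN Ncancel by (metis mult.commute)
      \<comment> \<open>The trace of \<open>A - A ** A\<close>, using that \<open>A ** A\<close> has
        trace \<open>t\<^sup>2 - 2 * d\<close>.\<close>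
      have "t * (1 - t) = n1 + n4 - (d + d)" by (simp add: n_def d t algebra_simps)
      then have tN: "t * (1 - t) \<in> N" using n dN by (simp add: Ncl)
      consider "t dvd 1" | "(1 - t) dvd 1" using local_cring_unit_or_unit[OF assms] by blast
      then show ?thesis
      proof cases
        case 1
        then have t1: "1 - t \<in> N" using tN Ncancel by blast
        obtain n where "d ^ n = 0" using Nnil[OF dN] by blast
        then obtain x where x: "d dvd x" "x\<^sup>2 - t * x + d = 0"
          using quadratic_root_of_nilpotent[OF 1] by blast
        have xN: "x \<in> N" using x(1) dN by (auto simp: dvd_def Nmul')
        have "t - x = 1 + - ((1 - t) + x)" by simp
        then have "t - x \<in> (+) 1 ` N" using t1 xN by (metis Nadd Nneg imageI)
        moreover have "(t - x)\<^sup>2 - t * (t - x) + d = 0"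
          using x(2) by (simp add: power2_eq_square algebra_simps)
        ultimately show ?thesis using xN x(2) by blast
      next
        case 2
        have "(1 - t) * a = n1 - d" "(1 - t) * b = n2" "(1 - t) * c = n3" "(1 - t) * e = n4 - d"
          by (simp_all add: n_def d t algebra_simps)
        then have "a \<in> N" "b \<in> N" "c \<in> N" "e \<in> N"
          using Ncancel[OF 2] n dN by (metis Nsub)+
        then have "A \<in> matrices_over N" by (simp add: matrices_over_2_iff abce)
        then show ?thesis by blast
      qed
    qed
  qed

  have clean_iff: "strongly_P_clean matrix_ring A \<longleftrightarrow>
      (\<exists>E W. E ** E = E \<and> W \<in> matrices_over N \<and> A = E + W \<and> E ** W = W ** E)"
    unfolding strongly_P_clean_def prime_radical_matrix_ring N_def by (simp add: matrix_ring_def)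
  have clean: "strongly_P_clean matrix_ring A"
    if "A \<in> matrices_over N \<or> mat 1 - A \<in> matrices_over N \<or>
      ((\<exists>x. x \<in> N \<and> x\<^sup>2 - t * x + d = 0) \<and> (\<exists>y. y \<in> (+) 1 ` N \<and> y\<^sup>2 - t * y + d = 0))"
    using that
  proof (elim disjE conjE exE)
    assume "A \<in> matrices_over N"
    then show ?thesis unfolding clean_iff by (intro exI[of _ 0] exI[of _ A]) simp
  next
    assume "mat 1 - A \<in> matrices_over N"
    then have "A - mat 1 \<in> matrices_over N"
      using Nneg[of "(mat 1 - A) $ i $ j" for i j] by (simp add: matrices_over_def)
    then show ?thesis unfolding clean_iff by (intro exI[of _ "mat 1"] exI[of _ "A - mat 1"]) simp
  next
    fix x y
    assume x: "x \<in> N" "x\<^sup>2 - t * x + d = 0" and y: "y \<in> (+) 1 ` N" "y\<^sup>2 - t * y + d = 0"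
    from y(1) obtain z where z: "z \<in> N" "y = 1 + z" by auto
    have "z - x \<in> N" using z x by (simp add: Nsub)
    then have "(1 + (z - x)) dvd 1" using Nnil one_plus_nilpotent_unit by blast
    then obtain u where u: "(y - x) * u = 1" by (auto simp: dvd_def z add_diff_eq)
    \<comment> \<open>Subtracting the two equations factors out \<open>y - x\<close>; as this is a
      unit, Vieta's formulas for \<open>t\<close> and \<open>d\<close> follow.\<close>
    have "(y - x) * (x + y - t) = (y\<^sup>2 - t * y + d) - (x\<^sup>2 - t * x + d)"
      by (simp add: power2_eq_square algebra_simps)
    then have "(y - x) * (x + y - t) = 0" using x y by simp
    then have "u * ((y - x) * (x + y - t)) = 0" by simp
    then have "((y - x) * u) * (x + y - t) = 0" by (simp only: ac_simps)
    then have txy: "t = x + y" using u by simp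
    have dxy: "d = x * y" using x(2) unfolding txy by (simp add: power2_eq_square algebra_simps)
    \<comment> \<open>The Lagrange interpolation polynomial with value \<open>0\<close> at
      \<open>x\<close> and \<open>1\<close> at \<open>y\<close>, evaluated at
      \<open>A\<close>.\<close>
    define E where "E = mat u ** (A - mat x)"
    have E_nth: "E $ i $ j = u * (A - mat x) $ i $ j" for i j
      unfolding E_def by (rule mat_mult_nth)
    have CH: "(A - mat x) ** (A - mat y) = 0"
    proof -
      have "a * a + b * c - (x + y) * a + x * y = 0" "e * e + b * c - (x + y) * e + x * y = 0"
        "b * (a + e - (x + y)) = 0" "c * (a + e - (x + y)) = 0"
        unfolding txy[symmetric] dxy[symmetric] t d by (simp_all add: algebra_simps)
      then show ?thesis
        by (simp add: vec_eq_iff forall_2 matrix_mult_2_nth mat_def abce[symmetric] algebra_simps)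
    qed
    have "E ** E = E"
    proof -
      let ?M = "A - mat x"
      \<comment> \<open>Splitting one factor as \<open>(A - mat y) + mat (y - x)\<close> lets the
        factored Cayley-Hamilton identity remove the first part, so squaring \<open>?M\<close> only
        scales it by \<open>y - x\<close>.\<close>
      have "?M ** ?M = ?M ** ((A - mat y) + mat (y - x))"
        by (rule arg_cong[where f = "(**) ?M"]) (simp add: vec_eq_iff mat_def)
      also have "\<dots> = ?M ** mat (y - x)" unfolding matrix_add_ldistrib CH by simp
      finally have MM: "?M ** ?M = ?M ** mat (y - x)" .
      have "(E ** E) $ i $ j = u * u * (?M ** ?M) $ i $ j" for i j
        by (simp only: matrix_mult_2_nth E_nth) (simp only: algebra_simps)
      then have "E ** E = mat (u * u) ** (?M ** ?M)"
        by (simp only: vec_eq_iff mat_mult_nth simp_thms)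
      also have "\<dots> = mat ((y - x) * u) ** E"
        unfolding MM by (simp add: E_def vec_eq_iff mat_mult_nth mult_mat_nth ac_simps)
      finally show ?thesis unfolding u by simp
    qed
    moreover have "A - E \<in> matrices_over N"
    proof -
      have u1: "1 - u \<in> N"
      proof -
        \<comment> \<open>The inverse of \<open>1 + (z - x)\<close> is congruent to \<open>1\<close>
          modulo \<open>N\<close>.\<close>
        have "1 - u = u * ((y - x) - 1)" using u by (simp add: algebra_simps)
        also have "\<dots> = u * (z - x)" by (simp add: z)
        finally show ?thesis using \<open>z - x \<in> N\<close> by (simp add: Nmul)
      qed
      have "A - E = mat (1 - u) ** A + mat (u * x)"
        by (simp add: E_nth vec_eq_iff mat_mult_nth) (simp add: mat_def algebra_simps)
      then show ?thesis using u1 x(1)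
        by (simp add: matrices_over_def mat_mult_nth) (simp add: mat_def Ncl)
    qed
    moreover have "E ** (A - E) = (A - E) ** E"
    proof -
      have "E ** A = A ** E"
        by (simp add: E_def vec_eq_iff forall_2 matrix_mult_2_nth mat_def algebra_simps)
      \<comment> \<open>Adding \<open>E ** E\<close> turns the two sides into \<open>E ** A\<close>
        and \<open>A ** E\<close>.\<close>
      then have "E ** (A - E) + E ** E = (A - E) ** E + E ** E"
        unfolding matrix_add_ldistrib[symmetric] matrix_add_rdistrib[symmetric] by simp
      then show ?thesis by simp
    qed
    ultimately show ?thesis unfolding clean_iff by (intro exI[of _ E] exI[of _ "A - E"]) simp
  qed

  show ?thesis
    using roots clean strongly_P_clean_imp_diff_square[of A] unfolding N_def td by blast
qed

end
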